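(* Let $p$ be a prime. Then \[ W_p \equiv -\overline{B}_1 \pmod{p}. \] For $p \geq 5$, we have \begin{align*} W_p &\equiv -2\overline{B}_1 + \overline{B}_2 - \tfrac{1}{2} p\, \overline{B}_1^2 \pmod{p^2},\\ W_p &\equiv -3\overline{B}_1 + 3\overline{B}_2 - \overline{B}_3 + p\left(-\tfrac{3}{2}\overline{B}_1^2 + \overline{B}_1\overline{B}_2\right) - p^2\left(\tfrac{1}{6}\overline{B}_1^3 + \tfrac{1}{3}\overline{B}_{1,2}\right) \pmod{p^3}. \end{align*} Equivalently, $(p-1)! \equiv -1 + p\,W_p \pmod{p^{r+1}}$ where, for $r=1$ (any prime $p$), $r=2$ and $r=3$ (primes $p\ge 5$), $W_p$ is replaced by the respective right-hand side above.
   Context: The Bernoulli numbers $B_n$ are defined by $\frac{t}{e^t-1}=\sum_{n\ge0}B_n\frac{t^n}{n!}$ (so $B_1=-\tfrac12$, $B_2=\tfrac16$). For a prime $p$, the Wilson quotient is $W_p = \frac{(p-1)!+1}{p}$. For $n\ge1$ define the divided Bernoulli numbers \[ \overline{B}_n = \frac{B_{n(p-1)} + \frac{1}{p} - 1}{n(p-1)}, \qquad \overline{B}_{n,2} = \frac{B_{n(p-1)-2}}{n(p-1)-2}, \] (for $p=2,3$ only $\overline{B}_1$ is used, defined by the same formula, giving $\overline{B}_1=-1$ for $p=2$ and $-\tfrac14$ for $p=3$). These are $p$-integral rationals; a congruence modulo $p^r$ between $p$-integral rationals means their difference lies in $p^r\mathbb{Z}_p$. *)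

theory Defs
  imports "HOL-Computational_Algebra.Computational_Algebra"
begin

(* The quotient is taken in the ring of formal power series over the rationals;
   it is exact, since t divides e^t - 1 with a unit as cofactor. *)
definition bernoulli :: "nat \<Rightarrow> rat" where
  "bernoulli n = fact n * fps_nth (fps_X / (fps_exp 1 - 1)) n"

definition wilson_quotient :: "nat \<Rightarrow> rat" where
  "wilson_quotient p = (fact (p - 1) + 1) / of_nat p"

definition div_bernoulli :: "nat \<Rightarrow> nat \<Rightarrow> rat" where
  "div_bernoulli p n =
     (bernoulli (n * (p - 1)) + 1 / of_nat p - 1) / of_nat (n * (p - 1))"

(* The natural subtraction does not truncate for p \<ge> 5 and n \<ge> 1. *)
definition div_bernoulli2 :: "nat \<Rightarrow> nat \<Rightarrow> rat" where
  "div_bernoulli2 p n = bernoulli (n * (p - 1) - 2) / of_nat (n * (p - 1) - 2)"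

(* A rational lies in the ring of p-adic integers iff p does not divide its
   denominator in lowest terms. *)
definition p_integral :: "nat \<Rightarrow> rat \<Rightarrow> bool" where
  "p_integral p x \<longleftrightarrow> \<not> int p dvd snd (quotient_of x)"

definition p_cong :: "nat \<Rightarrow> nat \<Rightarrow> rat \<Rightarrow> rat \<Rightarrow> bool" where
  "p_cong p r x y \<longleftrightarrow> (\<exists>z. p_integral p z \<and> x - y = of_nat p ^ r * z)"

end

theory Submission
  imports Defs "HOL-Number_Theory.Number_Theory"
begin

text \<open>Raising $(p-1)!$ to the power $p-1$ gives $(1 - p W_p)^{p-1} = \prod_{a<p} a^{p-1}$, a
  product of factors in $1 + p\mathbb{Z}_p$. For $p \ge 5$ the cubic truncation of the logarithm is
  a homomorphism modulo $p^4$ on $1 + p\mathbb{Z}_p$; it turns the product into a linear combination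
  of the power sums $S_n = \sum_{a<p} a^{n(p-1)}$ with $n \le 3$. Faulhaber's formula expresses
  $S_n$ modulo $p^4$ by $B_{n(p-1)}$ and $B_{n(p-1)-2}$, and the latter is reduced to $B_{p-3}$ by a
  Kummer congruence. Exponentiating back gives $W_p$ modulo $p^3$; the lower moduli follow from
  the divisibility of the finite differences $\sum_{a<p} (a^{p-1} - 1)^k$ by $p^k$.\<close>

subsection \<open>p-integral rationals\<close>

text \<open>Two features make the exponent p-1 harmless: it is even, which absorbs the sign in
  (p-1)! = -(1 - p W_p), and it is a p-adic unit, so the factor p-1 produced by the logarithm can be
  cancelled. The precision p^4 is dictated by the last step: W_p enters as p W_p, and dividing by p
  costs one power. The weights of the power sums come from (u-1) - (u-1)^2/2 + (u-1)^3/3 = 3u -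
  (3/2)u^2 + (1/3)u^3 - 11/6 at u = a^(p-1). Since S_n contains the divided Bernoulli number with a
  factor n, the weights 3, -3/2, 1/3 turn into 3, -3, 1, the coefficients of the linear part modulo
  p^3 up to sign. The obstacle is integrality: B_{n(p-1)} has p in its denominator, so it is not
  visible from the definition that the divided Bernoulli numbers are p-integral. The argument
  therefore handles p B_j, which is integral by induction, and the finite differences supply both
  the integrality of the divided numbers and the congruences among them.\<close>

lemma p_integral_iff:
  assumes "prime p"
  shows "p_integral p x \<longleftrightarrow> (\<exists>a b. \<not> int p dvd b \<and> x = of_int a / of_int b)"
proof
  assume "p_integral p x"
  moreover have "x = of_int (fst (quotient_of x)) / of_int (snd (quotient_of x))"
    by (simp add: quotient_of_div)
  ultimately show "\<exists>a b. \<not> int p dvd b \<and> x = of_int a / of_int b"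
    unfolding p_integral_def by blast
next
  assume "\<exists>a b. \<not> int p dvd b \<and> x = of_int a / of_int b"
  then obtain a b where b: "\<not> int p dvd b" and x: "x = of_int a / of_int b" by blast
  obtain c d where cd: "quotient_of x = (c, d)" by (cases "quotient_of x")
  have d: "d > 0" "coprime c d" "x = of_int c / of_int d"
    using cd quotient_of_denom_pos quotient_of_coprime quotient_of_div by auto
  have "b \<noteq> 0" using b by auto
  then have "(of_int (a * d) :: rat) = of_int (c * b)"
    using x d by (simp add: field_simps)
  then have "d dvd c * b" by (metis dvd_triv_right of_int_eq_iff)
  then have "d dvd b" using d(2) by (simp add: coprime_commute coprime_dvd_mult_right_iff)
  then show "p_integral p x" using b cd unfolding p_integral_def by (auto intro: dvd_trans)
qed

named_theorems p_integral_intros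

locale prime_nat =
  fixes p :: nat
  assumes prime: "prime p"
begin

lemma p_integral_of_int [p_integral_intros]: "p_integral p (of_int a)"
  unfolding p_integral_iff[OF prime] using prime
  by (intro exI[of _ a] exI[of _ 1]) (auto simp: prime_nat_iff)

lemma p_integral_of_nat [p_integral_intros]: "p_integral p (of_nat a)"
  using p_integral_of_int[of "int a"] by simp

lemma p_integral_0 [p_integral_intros]: "p_integral p 0"
  using p_integral_of_int[of 0] by simp

lemma p_integral_1 [p_integral_intros]: "p_integral p 1"
  using p_integral_of_int[of 1] by simp

lemma p_integral_numeral [p_integral_intros]: "p_integral p (numeral a)"
  using p_integral_of_int[of "numeral a"] by simp

lemma p_integral_add [p_integral_intros]:
  assumes "p_integral p x" "p_integral p y"
  shows "p_integral p (x + y)"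
proof -
  obtain a b c d where *: "\<not> int p dvd b" "x = of_int a / of_int b"
    "\<not> int p dvd d" "y = of_int c / of_int d"
    using assms unfolding p_integral_iff[OF prime] by blast
  then have "b \<noteq> 0" "d \<noteq> 0" by auto
  then have "x + y = of_int (a * d + c * b) / of_int (b * d)"
    using * by (simp add: field_simps)
  moreover have "\<not> int p dvd b * d" using * prime by (simp add: prime_dvd_mult_iff)
  ultimately show ?thesis unfolding p_integral_iff[OF prime] by blast
qed

lemma p_integral_mult [p_integral_intros]:
  assumes "p_integral p x" "p_integral p y"
  shows "p_integral p (x * y)"
proof -
  obtain a b c d where *: "\<not> int p dvd b" "x = of_int a / of_int b"
    "\<not> int p dvd d" "y = of_int c / of_int d"
    using assms unfolding p_integral_iff[OF prime] by blast
  then have "x * y = of_int (a * c) / of_int (b * d)" by simp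
  moreover have "\<not> int p dvd b * d" using * prime by (simp add: prime_dvd_mult_iff)
  ultimately show ?thesis unfolding p_integral_iff[OF prime] by blast
qed

lemma p_integral_minus [p_integral_intros]: "p_integral p x \<Longrightarrow> p_integral p (- x)"
  using p_integral_mult[OF p_integral_of_int[of "-1"], of x] by simp

lemma p_integral_diff [p_integral_intros]:
  "p_integral p x \<Longrightarrow> p_integral p y \<Longrightarrow> p_integral p (x - y)"
  using p_integral_add[of x "- y"] p_integral_minus[of y] by simp

lemma p_integral_power [p_integral_intros]: "p_integral p x \<Longrightarrow> p_integral p (x ^ n)"
  by (induction n) (auto intro!: p_integral_intros)

lemma p_integral_sum [p_integral_intros]:
  "(\<And>i. i \<in> A \<Longrightarrow> p_integral p (f i)) \<Longrightarrow> p_integral p (sum f A)"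
  by (induction A rule: infinite_finite_induct) (auto intro!: p_integral_intros)

lemma p_integral_divide_of_nat:
  assumes "p_integral p x" "\<not> p dvd n"
  shows "p_integral p (x / of_nat n)"
proof -
  have "p_integral p (1 / of_nat n)"
    unfolding p_integral_iff[OF prime] using assms(2)
    by (intro exI[of _ 1] exI[of _ "int n"]) auto
  from p_integral_mult[OF assms(1) this] show ?thesis by simp
qed

section \<open>Congruences between rationals modulo p^r\<close>

lemma p_cong_iff: "p_cong p r x y \<longleftrightarrow> p_cong p r (x - y) 0"
  by (simp add: p_cong_def)

lemma p_congI: "p_integral p z \<Longrightarrow> x - y = of_nat p ^ r * z \<Longrightarrow> p_cong p r x y"
  by (auto simp: p_cong_def)

lemma p_cong_0_iff: "p_cong p 0 x 0 \<longleftrightarrow> p_integral p x"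
  by (simp add: p_cong_def)

lemma p_cong_refl: "p_cong p r x x"
  using p_integral_0 by (auto simp: p_cong_def)

lemma p_cong_add:
  assumes "p_cong p r x y" "p_cong p r x' y'"
  shows "p_cong p r (x + x') (y + y')"
proof -
  obtain z z' where "p_integral p z" "x - y = of_nat p ^ r * z"
    "p_integral p z'" "x' - y' = of_nat p ^ r * z'"
    using assms by (auto simp: p_cong_def)
  then show ?thesis by (intro p_congI[of "z + z'"]) (auto intro: p_integral_intros simp: algebra_simps)
qed

lemma p_cong_scale:
  assumes "p_cong p r x y" "p_integral p c"
  shows "p_cong p r (c * x) (c * y)"
proof -
  obtain z where "p_integral p z" "x - y = of_nat p ^ r * z"
    using assms by (auto simp: p_cong_def)
  moreover from this have "c * x - c * y = of_nat p ^ r * (c * z)"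
    by (metis mult.left_commute right_diff_distrib)
  ultimately show ?thesis using assms by (intro p_congI[of "c * z"]) (auto intro: p_integral_intros)
qed

lemma p_cong_minus: "p_cong p r x y \<Longrightarrow> p_cong p r (- x) (- y)"
  using p_cong_scale[of r x y "-1"] p_integral_of_int[of "-1"] by simp

lemma p_cong_diff:
  "p_cong p r x y \<Longrightarrow> p_cong p r x' y' \<Longrightarrow> p_cong p r (x - x') (y - y')"
  using p_cong_add[of r x y "- x'" "- y'"] p_cong_minus[of r x' y'] by simp

lemma p_cong_sym: "p_cong p r x y \<Longrightarrow> p_cong p r y x"
  using p_cong_minus[of r "x - y" 0] p_cong_iff[of r x y] p_cong_iff[of r y x] by simp

lemma p_cong_trans [trans]: "p_cong p r x y \<Longrightarrow> p_cong p r y z \<Longrightarrow> p_cong p r x z"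
  using p_cong_add[of r "x - y" 0 "y - z" 0] p_cong_iff[of r] by simp

text \<open>The chain passes through \<open>x * y'\<close>, so integrality is asked of
  \<open>x\<close> and of \<open>y'\<close>. It has to be asked, because congruent rationals need
  not be p-integral themselves; only their difference is controlled.\<close>

lemma p_cong_mult:
  assumes "p_cong p r x y" "p_cong p r x' y'" "p_integral p x" "p_integral p y'"
  shows "p_cong p r (x * x') (y * y')"
proof -
  have "p_cong p r (x * x') (x * y')" by (rule p_cong_scale) fact+
  also have "p_cong p r (x * y') (y * y')"
    using p_cong_scale[OF assms(1) assms(4)] by (simp add: mult.commute)
  finally show ?thesis .
qed

lemma p_cong_power:
  assumes "p_cong p r x y" "p_integral p x" "p_integral p y"
  shows "p_cong p r (x ^ n) (y ^ n)"
  by (induction n) (use assms in \<open>auto intro!: p_cong_refl p_cong_mult p_integral_intros\<close>)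

lemma p_cong_mult_0:
  assumes "p_cong p r x 0" "p_cong p s y 0"
  shows "p_cong p (r + s) (x * y) 0"
proof -
  obtain z z' where "p_integral p z" "x = of_nat p ^ r * z"
    "p_integral p z'" "y = of_nat p ^ s * z'"
    using assms by (auto simp: p_cong_def)
  then show ?thesis
    by (intro p_congI[of "z * z'"]) (auto intro: p_integral_intros simp: power_add)
qed

lemma p_cong_mono:
  assumes "p_cong p s x y" "r \<le> s"
  shows "p_cong p r x y"
proof -
  obtain z where "p_integral p z" "x - y = of_nat p ^ s * z"
    using assms by (auto simp: p_cong_def)
  then show ?thesis using assms(2)
    by (intro p_congI[of "of_nat p ^ (s - r) * z"])
      (auto intro: p_integral_intros simp flip: power_add mult.assoc)
qed

lemma p_cong_sum:
  "(\<And>i. i \<in> A \<Longrightarrow> p_cong p r (f i) (g i)) \<Longrightarrow> p_cong p r (sum f A) (sum g A)"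
  by (induction A rule: infinite_finite_induct) (auto intro: p_cong_refl p_cong_add)

text \<open>Dividing by p^r costs r powers in the modulus. This turns statements about p W_p and p
  B_j into statements about W_p and B_j; with \<open>s = 0\<close> it yields integrality.\<close>

lemma p_cong_prime_power_mult_iff:
  "p_cong p (r + s) (of_nat p ^ r * x) (of_nat p ^ r * y) \<longleftrightarrow> p_cong p s x y"
proof -
  have "(of_nat p :: rat) \<noteq> 0" using prime by auto
  then have "of_nat p ^ r * x - of_nat p ^ r * y = of_nat p ^ (r + s) * z \<longleftrightarrow>
      x - y = of_nat p ^ s * z" for z
    by (metis (no_types, lifting) mult.assoc mult_cancel_left power_add power_not_zero right_diff_distrib)
  then show ?thesis by (simp add: p_cong_def)
qed

lemma p_cong_prime_mult_iff:
  "p_cong p (Suc s) (of_nat p * x) (of_nat p * y) \<longleftrightarrow> p_cong p s x y"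
  using p_cong_prime_power_mult_iff[of 1 s x y] by simp

lemma p_cong_cancel:
  assumes "p_cong p r (of_nat n * x) (of_nat n * y)" "\<not> p dvd n"
  shows "p_cong p r x y"
proof -
  have "n \<noteq> 0" using assms(2) by (metis dvd_0_right)
  then show ?thesis
    using p_cong_scale[OF assms(1) p_integral_divide_of_nat[OF p_integral_1 assms(2)]] by simp
qed

lemma p_integral_cong:
  assumes "p_cong p r x y" "p_integral p y"
  shows "p_integral p x"
proof -
  obtain z where "p_integral p z" "x = y + of_nat p ^ r * z"
    using assms by (auto simp: p_cong_def algebra_simps)
  then show ?thesis using assms by (auto intro!: p_integral_intros)
qed

lemma p_cong_of_int:
  assumes "[a = b] (mod int p ^ r)"
  shows "p_cong p r (of_int a) (of_int b)"
proof -
  obtain k where "a - b = int p ^ r * k"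
    using assms by (auto simp: cong_iff_dvd_diff)
  then have "(of_int a - of_int b :: rat) = of_nat p ^ r * of_int k"
    by (metis of_int_diff of_int_mult of_int_of_nat_eq of_int_power)
  then show ?thesis by (rule p_congI[OF p_integral_of_int])
qed

end

subsection \<open>Bernoulli numbers and power sums\<close>

lemma bernoulli_fps: "fps_X / (fps_exp 1 - 1) * (fps_exp 1 - 1) = (fps_X :: rat fps)"
proof -
  have "subdegree (fps_exp 1 - 1 :: rat fps) = 1"
    by (rule subdegreeI) auto
  then have "(fps_exp 1 - 1 :: rat fps) dvd fps_X"
    by (subst fps_dvd_iff) (auto simp: fps_eq_iff intro: exI[of _ 1])
  then show ?thesis by simp
qed

text \<open>Faulhaber's formula, read off at t^m from \<Sum> e^(at) = t/(e^t - 1) * (e^(Nt) - 1)/t,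
  where \<open>G\<close> is the second factor. The index \<open>i\<close> follows the power of
  \<open>N\<close>, so that for N = p later terms tend to be p-adically smaller.\<close>

lemma sum_powers_bernoulli:
  "(\<Sum>a<N. of_nat a ^ m) =
   (\<Sum>i\<le>m. of_nat (m choose i) * bernoulli (m - i) * (of_nat N ^ Suc i / of_nat (Suc i)))"
proof -
  define F :: "rat fps" where "F = fps_X / (fps_exp 1 - 1)"
  define E :: "rat fps" where "E = fps_exp 1 - 1"
  define G :: "rat fps" where "G = Abs_fps (\<lambda>i. of_nat N ^ Suc i / fact (Suc i))"
  have FE: "F * E = fps_X" unfolding F_def E_def by (rule bernoulli_fps)
  have F: "fps_nth F i = bernoulli i / fact i" for i by (simp add: F_def bernoulli_def)
  have G: "fps_X * G = fps_exp (of_nat N) - 1"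
  proof (rule fps_ext)
    show "fps_nth (fps_X * G) i = fps_nth (fps_exp (of_nat N) - 1) i" for i
      by (cases i) (simp_all add: G_def field_simps)
  qed
  have "(\<Sum>a<N. fps_exp (of_nat a)) * E = fps_exp (of_nat N) - (1 :: rat fps)"
    by (induction N) (simp_all add: E_def algebra_simps fps_exp_add_mult)
  also have "\<dots> = F * E * G" by (simp only: FE G)
  also have "\<dots> = G * F * E" by (simp only: mult_ac)
  finally have "(\<Sum>a<N. fps_exp (of_nat a)) * E = G * F * E" .
  moreover have "fps_nth E 1 \<noteq> fps_nth 0 1" by (simp add: E_def)
  then have "E \<noteq> 0" by auto
  ultimately have "(\<Sum>a<N. fps_exp (of_nat a)) = G * F" by simp
  then have "fact m * fps_nth (\<Sum>a<N. fps_exp (of_nat a)) m = fact m * fps_nth (G * F) m" by simp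
  then have "(\<Sum>a<N. of_nat a ^ m) =
      (\<Sum>i\<le>m. fact m * (of_nat N ^ Suc i / fact (Suc i) * (bernoulli (m - i) / fact (m - i))))"
    by (simp add: fps_sum_nth fps_mult_nth F G_def sum_distrib_left atLeast0AtMost)
  also have "\<dots> = (\<Sum>i\<le>m. of_nat (m choose i) * bernoulli (m - i) * (of_nat N ^ Suc i / of_nat (Suc i)))"
    by (intro sum.cong refl) (simp add: binomial_fact mult_ac)
  finally show ?thesis .
qed

text \<open>The series F = t/(e^t - 1) satisfies F(-t) = F(t) + t. Away from degree 1, an odd
  coefficient therefore equals its own negative.\<close>

lemma bernoulli_odd:
  assumes "odd n" "n \<noteq> 1"
  shows "bernoulli n = 0"
proof -
  define F :: "rat fps" where "F = fps_X / (fps_exp 1 - 1)"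
  let ?G = "F oo (- fps_X)"
  have FE: "F * (fps_exp 1 - 1) = fps_X" unfolding F_def by (rule bernoulli_fps)
  have "(F * (fps_exp 1 - 1)) oo (- fps_X) = - fps_X"
    by (simp add: FE)
  then have "?G * (fps_exp (-1) - 1) = - fps_X"
    by (simp add: fps_compose_mult_distrib fps_compose_sub_distrib)
  then have "?G * (fps_exp (-1) - 1) * fps_exp 1 = - fps_X * fps_exp 1" by (rule arg_cong)
  then have "?G * ((fps_exp (-1) - 1) * fps_exp 1) = - fps_X * fps_exp 1" by (simp only: mult.assoc)
  moreover have "(fps_exp (-1) - 1) * fps_exp 1 = - (fps_exp 1 - 1 :: rat fps)"
    by (simp add: left_diff_distrib fps_exp_add_mult[symmetric])
  ultimately have "?G * - (fps_exp 1 - 1) = - fps_X * fps_exp 1" by (simp only:)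
  then have "?G * (fps_exp 1 - 1) = fps_X * fps_exp 1"
    by (simp only: mult_minus_left mult_minus_right neg_equal_iff_equal)
  also have "\<dots> = fps_X + fps_X * (fps_exp 1 - 1)" by (simp add: right_diff_distrib)
  also have "\<dots> = (F + fps_X) * (fps_exp 1 - 1)" by (simp only: distrib_right FE)
  finally have "?G * (fps_exp 1 - 1) = (F + fps_X) * (fps_exp 1 - 1)" .
  moreover have "fps_nth (fps_exp 1 - 1 :: rat fps) 1 \<noteq> fps_nth 0 1" by simp
  then have "(fps_exp 1 - 1 :: rat fps) \<noteq> 0" by metis
  ultimately have "?G = F + fps_X" by simp
  then have "fps_nth ?G n = fps_nth (F + fps_X) n" by simp
  then have "fps_nth F n = 0" using assms by (simp add: fps_compose_uminus')
  then show ?thesis by (simp add: bernoulli_def F_def)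
qed

subsection \<open>Power sums modulo the square of a prime\<close>

lemma one_plus_power_cong: "[(1 + x) ^ n = 1 + int n * x] (mod x\<^sup>2)"
proof (induction n)
  case (Suc n)
  then have "[(1 + x) * (1 + x) ^ n = (1 + x) * (1 + int n * x)] (mod x\<^sup>2)"
    by (rule cong_scalar_left)
  also have "(1 + x) * (1 + int n * x) = 1 + int (Suc n) * x + int n * x\<^sup>2"
    by (simp add: algebra_simps power2_eq_square)
  also have "[\<dots> = 1 + int (Suc n) * x] (mod x\<^sup>2)"
    by (simp add: cong_iff_dvd_diff)
  finally show ?case by simp
qed simp

text \<open>In a^p - b^p = (a - b) * (\<Sum> b^(p-1-i) a^i) both factors are divisible by p: modulo
  p the second is a sum of p equal terms.\<close>

lemma power_cong_square:
  fixes a b :: int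
  assumes "[a = b] (mod int p)"
  shows "[a ^ p = b ^ p] (mod (int p)\<^sup>2)"
proof -
  have "[(\<Sum>i<p. b ^ (p - Suc i) * a ^ i) = (\<Sum>i<p. b ^ (p - Suc i) * b ^ i)] (mod int p)"
    by (intro cong_sum cong_mult cong_pow cong_refl assms)
  also have "(\<Sum>i<p. b ^ (p - Suc i) * b ^ i) = (\<Sum>i<p. b ^ (p - 1))"
    by (intro sum.cong refl) (simp flip: power_add)
  finally have "int p dvd (\<Sum>i<p. b ^ (p - Suc i) * a ^ i)"
    by (simp add: cong_dvd_iff)
  then have "int p * int p dvd (a - b) * (\<Sum>i<p. b ^ (p - Suc i) * a ^ i)"
    using assms by (intro mult_dvd_mono) (simp_all add: cong_iff_dvd_diff)
  then show ?thesis
    by (simp add: cong_iff_dvd_diff power_diff_sumr2 power2_eq_square)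
qed

text \<open>Integer-valued, so that library congruences apply, and restricted to residues prime to
  p, so that Fermat's theorem holds for every summand.\<close>

definition power_sum :: "nat \<Rightarrow> nat \<Rightarrow> int" where
  "power_sum p k = (\<Sum>a\<in>{1..<p}. int a ^ k)"

lemma of_int_power_sum:
  assumes "k > 0"
  shows "of_int (power_sum p k) = (\<Sum>a<p. of_nat a ^ k :: rat)"
proof -
  have "(\<Sum>a<p. of_nat a ^ k :: rat) = (\<Sum>a\<in>{1..<p}. of_nat a ^ k)"
    using assms by (intro sum.mono_neutral_right) (auto simp: not_le)
  then show ?thesis by (simp add: power_sum_def)
qed

text \<open>Multiplication by \<open>g\<close> permutes the nonzero residues. Because the exponent
  is a multiple of p, replacing a residue by a congruent one changes the power only modulo p^2, so
  the sum S satisfies (g^(kp) - 1) S = 0 modulo p^2. By Fermat g^(kp) = g^k modulo p, hence the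
  first factor is a unit.\<close>

lemma square_dvd_power_sum:
  assumes "prime p" "\<not> p dvd g" "\<not> int p dvd int g ^ k - 1"
  shows "(int p)\<^sup>2 dvd power_sum p (k * p)"
proof -
  let ?f = "\<lambda>a. g * a mod p"
  have "coprime g p" using assms by (metis coprime_commute prime_imp_coprime)
  have "inj_on ?f {1..<p}"
  proof (rule inj_onI)
    fix a b assume ab: "a \<in> {1..<p}" "b \<in> {1..<p}" "?f a = ?f b"
    then have "[a = b] (mod p)"
      using \<open>coprime g p\<close> cong_mult_lcancel_nat by (simp add: cong_def)
    then show "a = b" using ab by (simp add: cong_def)
  qed
  moreover have "?f ` {1..<p} \<subseteq> {1..<p}"
  proof
    fix y assume "y \<in> ?f ` {1..<p}"
    then obtain a where a: "a \<in> {1..<p}" "y = ?f a" by auto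
    then have "\<not> p dvd a" by (auto dest: dvd_imp_le)
    then have "\<not> p dvd g * a" using assms by (simp add: prime_dvd_mult_iff)
    then show "y \<in> {1..<p}"
      using a prime_gt_0_nat[OF assms(1)] by (auto simp: Suc_le_eq dvd_eq_mod_eq_0)
  qed
  ultimately have "bij_betw ?f {1..<p} {1..<p}"
    by (simp add: bij_betw_def endo_inj_surj)
  then have "power_sum p (k * p) = (\<Sum>a\<in>{1..<p}. int (?f a) ^ (k * p))"
    unfolding power_sum_def by (rule sum.reindex_bij_betw[symmetric])
  also have "[\<dots> = (\<Sum>a\<in>{1..<p}. int g ^ (k * p) * int a ^ (k * p))] (mod (int p)\<^sup>2)"
  proof (intro cong_sum)
    fix a
    have "[int (?f a) = int g * int a] (mod int p)"
      by (metis cong_int_iff cong_mod_left cong_refl of_nat_mult)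
    then have "[(int (?f a) ^ p) ^ k = ((int g * int a) ^ p) ^ k] (mod (int p)\<^sup>2)"
      by (intro cong_pow power_cong_square)
    then show "[int (?f a) ^ (k * p) = int g ^ (k * p) * int a ^ (k * p)] (mod (int p)\<^sup>2)"
      by (simp add: mult.commute[of k p] power_mult power_mult_distrib)
  qed
  also have "(\<Sum>a\<in>{1..<p}. int g ^ (k * p) * int a ^ (k * p)) =
      int g ^ (k * p) * power_sum p (k * p)"
    by (simp add: power_sum_def sum_distrib_left)
  finally have "(int p)\<^sup>2 dvd (int g ^ (k * p) - 1) * power_sum p (k * p)"
    by (simp add: cong_iff_dvd_diff algebra_simps dvd_diff_commute)
  moreover have "\<not> int p dvd int g ^ (k * p) - 1"
  proof -
    have "[(g ^ k) ^ (p - 1) = 1] (mod p)"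
      using assms prime_dvd_power_nat by (intro fermat_theorem) auto
    then have "[int g ^ k * (int g ^ k) ^ (p - 1) = int g ^ k * 1] (mod int p)"
      using cong_int_iff[of "(g ^ k) ^ (p - 1)" 1 p] by (intro cong_mult cong_refl) simp
    moreover have "int g ^ k * (int g ^ k) ^ (p - 1) = int g ^ (k * p)"
      using prime_gt_0_nat[OF assms(1)] by (cases p) (simp_all add: power_mult power_add)
    ultimately have "[int g ^ (k * p) - 1 = int g ^ k - 1] (mod int p)"
      by (simp add: cong_diff)
    then show ?thesis using assms(3) by (simp add: cong_dvd_iff)
  qed
  then have "coprime ((int p)\<^sup>2) (int g ^ (k * p) - 1)"
    using assms(1) by (simp add: prime_imp_coprime)
  ultimately show ?thesis by (simp add: coprime_dvd_mult_right_iff)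
qed

lemma int_fermat:
  assumes "prime p" "a \<in> {1..<p}"
  shows "[int a ^ (p - 1) = 1] (mod int p)"
proof -
  have "\<not> p dvd a" using assms by (auto dest: dvd_imp_le)
  from fermat_theorem[OF assms(1) this] show ?thesis
    using cong_int_iff[of "a ^ (p - 1)" 1 p] by simp
qed

text \<open>With a^(p-1) = 1 + x and p dividing x, the factor (1 + x)^n is linear in n modulo p^2,
  and the slope does not depend on n.\<close>

lemma power_sum_shift:
  assumes "prime p"
  shows "[power_sum p (k + n * (p - 1)) =
      power_sum p k + int n * (\<Sum>a\<in>{1..<p}. int a ^ k * (int a ^ (p - 1) - 1))] (mod (int p)\<^sup>2)"
proof -
  have "[power_sum p (k + n * (p - 1)) =
      (\<Sum>a\<in>{1..<p}. int a ^ k * (1 + int n * (int a ^ (p - 1) - 1)))] (mod (int p)\<^sup>2)"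
    unfolding power_sum_def
  proof (rule cong_sum)
    fix a assume a: "a \<in> {1..<p}"
    define x where "x = int a ^ (p - 1) - 1"
    have "int p dvd x" using int_fermat[OF assms a] by (simp add: x_def cong_iff_dvd_diff)
    then have "(int p)\<^sup>2 dvd x\<^sup>2" by simp
    then have "[(1 + x) ^ n = 1 + int n * x] (mod (int p)\<^sup>2)"
      by (rule cong_dvd_modulus[OF one_plus_power_cong])
    then have "[int a ^ k * (1 + x) ^ n = int a ^ k * (1 + int n * x)] (mod (int p)\<^sup>2)"
      by (rule cong_scalar_left)
    moreover have "int a ^ k * (1 + x) ^ n = int a ^ (k + n * (p - 1))"
      by (simp add: x_def power_add power_mult mult.commute[of n])
    ultimately show "[int a ^ (k + n * (p - 1)) = int a ^ k * (1 + int n * (int a ^ (p - 1) - 1))]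
        (mod (int p)\<^sup>2)"
      by (simp add: x_def)
  qed
  then show ?thesis
    by (simp add: power_sum_def sum_distrib_left algebra_simps sum.distrib sum_subtractf)
qed

locale prime_ge5 = prime_nat +
  assumes ge5: "p \<ge> 5"
begin

text \<open>By Fermat 2^(p-3) is inverse to 4 modulo p, and 4 = 1 would force p to divide 3. This
  makes 2 an admissible multiplier \<open>g\<close> for the exponent (p-3)p.\<close>

lemma two_power_not_cong_1: "\<not> int p dvd 2 ^ (p - 3) - 1"
proof
  assume *: "int p dvd 2 ^ (p - 3) - 1"
  have "[2 ^ (p - 1) = 1] (mod int p)"
    using int_fermat[OF prime, of 2] ge5 by simp
  moreover have "2 ^ (p - 1) = 4 * (2 :: int) ^ (p - 3)"
  proof -
    have "p - 1 = 2 + (p - 3)" using ge5 by simp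
    then show ?thesis by (simp only: power_add) simp
  qed
  ultimately have "int p dvd 4 * 2 ^ (p - 3) - 1" by (simp add: cong_iff_dvd_diff)
  then have "int p dvd (4 * 2 ^ (p - 3) - 1) - 4 * (2 ^ (p - 3) - 1)"
    by (rule dvd_diff[OF _ dvd_mult[OF *]])
  then have "int p dvd 3" by simp
  then show False using ge5 by (auto dest: zdvd_imp_le)
qed

text \<open>Modulo $p^2$ the power sums $P(k + n(p-1))$ are affine in $n$; for $k = n = p - 3$ the
  exponent is a multiple of $p$ and the sum vanishes, which determines the slope.\<close>

lemma power_sum_kummer:
  "[3 * power_sum p (p - 3 + n * (p - 1)) = int (3 + n) * power_sum p (p - 3)] (mod (int p)\<^sup>2)"
  "int p dvd power_sum p (p - 3)"
proof -
  define D where "D = (\<Sum>a\<in>{1..<p}. int a ^ (p - 3) * (int a ^ (p - 1) - 1))"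
  let ?T = "power_sum p (p - 3)"
  have "int p dvd D" unfolding D_def
    using int_fermat[OF prime] by (intro dvd_sum dvd_mult) (simp add: cong_iff_dvd_diff)
  then have pD: "(int p)\<^sup>2 dvd int p * D" by (simp add: power2_eq_square)
  have shift: "[power_sum p (p - 3 + n * (p - 1)) = ?T + int n * D] (mod (int p)\<^sup>2)" for n
    unfolding D_def by (rule power_sum_shift[OF prime])
  have "\<not> p dvd 2" using ge5 by (auto dest: dvd_imp_le)
  then have "(int p)\<^sup>2 dvd power_sum p ((p - 3) * p)"
    using square_dvd_power_sum[OF prime, of 2] two_power_not_cong_1 by simp
  also have "(p - 3) * p = p - 3 + (p - 3) * (p - 1)"
  proof -
    obtain q where "p = 5 + q" using ge5 le_Suc_ex by blast
    then show ?thesis by (simp add: algebra_simps)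
  qed
  finally have "(int p)\<^sup>2 dvd ?T + int (p - 3) * D"
    using shift[of "p - 3"] by (simp add: cong_dvd_iff)
  \<comment> \<open>As p divides \<open>D\<close>, the term \<open>int p * D\<close> vanishes modulo
    p^2, so the coefficient p - 3 may be replaced by -3. Hence \<open>?T\<close> is 3 times the
    slope, which explains the factor 3 in the claim.\<close>
  then have "(int p)\<^sup>2 dvd ?T + int (p - 3) * D - int p * D"
    using pD by (rule dvd_diff)
  also have "?T + int (p - 3) * D - int p * D = ?T - 3 * D"
    using ge5 by (simp add: of_nat_diff algebra_simps)
  finally have T: "(int p)\<^sup>2 dvd ?T - 3 * D" .
  have "int p dvd (int p)\<^sup>2" by (simp add: power2_eq_square)
  then have "int p dvd ?T - 3 * D" using T by (rule dvd_trans)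
  then have "int p dvd ?T - 3 * D + 3 * D" using \<open>int p dvd D\<close> by (intro dvd_add dvd_mult)
  then show "int p dvd ?T" by simp
  have "[3 * power_sum p (p - 3 + n * (p - 1)) = 3 * (?T + int n * D)] (mod (int p)\<^sup>2)"
    using shift by (rule cong_scalar_left)
  moreover have "[3 * (?T + int n * D) = int (3 + n) * ?T] (mod (int p)\<^sup>2)"
  proof -
    have "3 * (?T + int n * D) - int (3 + n) * ?T = - (int n * (?T - 3 * D))"
      by (simp add: algebra_simps)
    then show ?thesis using T by (simp add: cong_iff_dvd_diff del: of_nat_add)
  qed
  ultimately show "[3 * power_sum p (p - 3 + n * (p - 1)) = int (3 + n) * ?T] (mod (int p)\<^sup>2)"
    by (rule cong_trans)
qed

end

subsection \<open>Bernoulli numbers at a prime\<close>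

lemma bernoulli_0: "bernoulli 0 = 1"
  using sum_powers_bernoulli[where m = 0 and N = 1] by simp

lemma bernoulli_1: "bernoulli 1 = - 1 / 2"
  using sum_powers_bernoulli[where m = 1 and N = 1] by (simp add: bernoulli_0)

lemma bernoulli_2: "bernoulli 2 = 1 / 6"
  using sum_powers_bernoulli[where m = 2 and N = 1]
  by (simp add: bernoulli_0 bernoulli_1[simplified] numeral_2_eq_2)

text \<open>A positive n below p^(e+1) has p-adic valuation at most e.\<close>

lemma (in prime_nat) p_integral_prime_power_divide:
  assumes "n > 0" "n < p ^ Suc e"
  shows "p_integral p (of_nat p ^ e / of_nat n)"
proof -
  obtain m where m: "n = p ^ multiplicity p n * m" "\<not> p dvd m"
    using multiplicity_decompose'[of n p] assms prime not_prime_unit by blast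
  define k where "k = multiplicity p n"
  have "p ^ k \<le> n" using assms(1) by (simp add: k_def dvd_imp_le multiplicity_dvd)
  then have "p ^ k < p ^ Suc e" using assms by simp
  then have "k \<le> e" using prime_gt_1_nat[OF prime] by (simp only: power_strict_increasing_iff)
  then have "of_nat p ^ e = (of_nat p ^ k * of_nat p ^ (e - k) :: rat)" by (simp flip: power_add)
  moreover have "(of_nat n :: rat) = of_nat p ^ k * of_nat m"
    using m(1) by (metis k_def of_nat_mult of_nat_power)
  moreover have "(of_nat p ^ k :: rat) \<noteq> 0" using prime by auto
  ultimately have "of_nat p ^ e / of_nat n = (of_nat p ^ (e - k) / of_nat m :: rat)"
    by (metis mult_divide_mult_cancel_left)
  then show ?thesis
    using p_integral_divide_of_nat[OF _ m(2)] by (auto intro: p_integral_intros)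
qed

context prime_ge5
begin

lemma not_dvd_less: "0 < n \<Longrightarrow> n < p \<Longrightarrow> \<not> p dvd n"
  by (auto dest: dvd_imp_le)

lemma p_integral_divide_numeral:
  assumes "p_integral p x"
  shows "p_integral p (x / 2)" "p_integral p (x / 3)" "p_integral p (x / 4)" "p_integral p (x / 6)"
proof -
  have 2: "p_integral p (x / 2)" if "p_integral p x" for x
    using p_integral_divide_of_nat[OF that, of 2] not_dvd_less[of 2] ge5 by simp
  have 3: "p_integral p (x / 3)" if "p_integral p x" for x
    using p_integral_divide_of_nat[OF that, of 3] not_dvd_less[of 3] ge5 by simp
  show "p_integral p (x / 2)" "p_integral p (x / 3)" using 2 3 assms by auto
  show "p_integral p (x / 4)" using 2[OF 2[OF assms]] by simp
  show "p_integral p (x / 6)" using 2[OF 3[OF assms]] by simp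
qed

text \<open>For i = j + 2 this bounds i + 1 by p^(i-1), so i + 1 has valuation at most i - 2 and
  p^i/(i+1) keeps two factors p. The start j = 0 is where p > 3 enters.\<close>

lemma less_prime_power: "j + 3 < p ^ Suc j"
proof (induction j)
  case (Suc j)
  have "Suc j + 3 < 5 * (j + 3)" by simp
  also have "\<dots> \<le> p * p ^ Suc j" using Suc ge5 by (intro mult_le_mono) auto
  finally show ?case by simp
qed (use ge5 in simp)

lemma prime_power_divide_Suc_cong:
  assumes "i \<ge> 2"
  shows "p_cong p 2 (of_nat p ^ i / of_nat (Suc i)) 0"
proof -
  obtain j where i: "i = j + 2" using assms by (metis add.commute le_Suc_ex)
  have "p_integral p (of_nat p ^ j / of_nat (Suc i))"
    using less_prime_power[of j] by (intro p_integral_prime_power_divide) (auto simp: i)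
  then show ?thesis by (rule p_congI) (simp add: i power_add power2_eq_square)
qed

text \<open>Faulhaber's formula at N = p, solved for its term i = 0. One factor p stays attached to
  each Bernoulli number, so this is a recursion for p B_j with coefficients containing
  p^i/(i+1).\<close>

lemma p_bernoulli_eq:
  "of_nat p * bernoulli j = (\<Sum>a<p. of_nat a ^ j) -
     (\<Sum>i\<in>{1..j}. of_nat (j choose i) * (of_nat p * bernoulli (j - i)) * (of_nat p ^ i / of_nat (Suc i)))"
proof -
  have "{..j} = insert 0 {1..j}" by auto
  then show ?thesis
    by (simp add: sum_powers_bernoulli mult_ac del: of_nat_Suc)
qed

lemma p_integral_prime_power_divide_Suc: "p_integral p (of_nat p ^ i / of_nat (Suc i))"
proof (cases "i \<ge> 2")
  case True
  then show ?thesis using prime_power_divide_Suc_cong p_integral_cong p_integral_0 by blast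
next
  case False
  then have "i = 0 \<or> i = 1" by auto
  then show ?thesis by (auto intro!: p_integral_intros p_integral_divide_numeral)
qed

text \<open>The bound on denominators in the von Staudt-Clausen theorem: p occurs at most once in
  the denominator of B_j.\<close>

lemma p_integral_p_bernoulli: "p_integral p (of_nat p * bernoulli j)"
proof (induction j rule: less_induct)
  case (less j)
  have "p_integral p (of_nat (j choose i) * (of_nat p * bernoulli (j - i)) * (of_nat p ^ i / of_nat (Suc i)))"
    if "i \<in> {1..j}" for i
    using that
    by (intro p_integral_mult[OF p_integral_mult] p_integral_of_nat p_integral_prime_power_divide_Suc less) auto
  then show ?case
    unfolding p_bernoulli_eq[of j]
    by (intro p_integral_diff p_integral_sum p_integral_power p_integral_of_nat)
qed

lemma p_integral_bernoulli_odd: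
  assumes "odd j"
  shows "p_integral p (bernoulli j)"
proof (cases "j = 1")
  case True
  have "p_integral p (- 1 / 2)" by (intro p_integral_divide_numeral p_integral_intros)
  then show ?thesis using True bernoulli_1 by simp
next
  case False
  then show ?thesis using assms by (simp add: bernoulli_odd p_integral_0)
qed

text \<open>The delicate term of the recursion is i = 1, where p^i/(i+1) = p/2 supplies only one
  factor p. The second is the p in p B_{j-1}: as j - 1 is odd, B_{j-1} is 0 or -1/2 and hence
  integral.\<close>

lemma p_bernoulli_cong_power_sum:
  assumes "even j" "j > 0"
  shows "p_cong p 2 (of_nat p * bernoulli j) (of_int (power_sum p j))"
proof -
  let ?t = "\<lambda>i. of_nat (j choose i) * (of_nat p * bernoulli (j - i)) * (of_nat p ^ i / of_nat (Suc i))"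
  have "p_cong p 2 (?t i) 0" if "i \<in> {1..j}" for i
  proof (cases "i = 1")
    case True
    have "p_integral p (of_nat j * bernoulli (j - 1) / 2)"
      using assms by (intro p_integral_divide_numeral p_integral_intros p_integral_bernoulli_odd) auto
    then show ?thesis
      by (rule p_congI) (simp add: True power2_eq_square)
  next
    case False
    then have "p_cong p 2 (of_nat p ^ i / of_nat (Suc i)) 0"
      using that by (intro prime_power_divide_Suc_cong) auto
    from p_cong_scale[OF this, of "of_nat (j choose i) * (of_nat p * bernoulli (j - i))"]
    show ?thesis by (simp add: p_integral_intros p_integral_p_bernoulli del: of_nat_Suc)
  qed
  then have "p_cong p 2 (sum ?t {1..j}) (\<Sum>i\<in>{1..j}. 0)" by (rule p_cong_sum)
  then have "p_cong p 2 (of_int (power_sum p j) - sum ?t {1..j}) (of_int (power_sum p j) - 0)"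
    by (intro p_cong_diff p_cong_refl) simp
  then show ?thesis
    using p_bernoulli_eq[of j] of_int_power_sum[of j p] assms by simp
qed

lemma even_prime_minus_1: "even (p - 1)"
  using prime ge5 prime_odd_nat[of p] by auto

text \<open>The indices p - 3 + n(p-1) and p - 3 are -(3+n) and -3 modulo p, so this is Kummer's
  congruence for B_k/k with denominators cleared; the form stays meaningful when p divides k. It
  comes from the power sum version by dividing by p.\<close>

lemma bernoulli_kummer:
  "p_cong p 1 (3 * bernoulli (p - 3 + n * (p - 1))) (of_nat (3 + n) * bernoulli (p - 3))"
  "p_integral p (bernoulli (p - 3))"
proof -
  have even: "even (p - 3 + n * (p - 1))" "p - 3 + n * (p - 1) > 0" for n
    using even_prime_minus_1 ge5 by auto
  have B: "p_cong p 2 (of_nat p * bernoulli (p - 3 + n * (p - 1)))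
      (of_int (power_sum p (p - 3 + n * (p - 1))))" for n
    using even by (rule p_bernoulli_cong_power_sum)
  have "p_cong p 2 (3 * (of_nat p * bernoulli (p - 3 + n * (p - 1))))
      (3 * of_int (power_sum p (p - 3 + n * (p - 1))))"
    by (intro p_cong_scale B p_integral_intros)
  also have "p_cong p 2 (3 * of_int (power_sum p (p - 3 + n * (p - 1))))
      (of_nat (3 + n) * of_int (power_sum p (p - 3)))"
    using p_cong_of_int[OF power_sum_kummer(1)[of n]] by simp
  also have "p_cong p 2 (of_nat (3 + n) * of_int (power_sum p (p - 3)))
      (of_nat (3 + n) * (of_nat p * bernoulli (p - 3)))"
    using p_cong_sym[OF B[of 0]] by (intro p_cong_scale p_integral_intros) simp
  finally have "p_cong p (Suc 1) (of_nat p * (3 * bernoulli (p - 3 + n * (p - 1))))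
      (of_nat p * (of_nat (3 + n) * bernoulli (p - 3)))"
    by (simp only: mult_ac numeral_2_eq_2 One_nat_def)
  then show "p_cong p 1 (3 * bernoulli (p - 3 + n * (p - 1))) (of_nat (3 + n) * bernoulli (p - 3))"
    by (simp only: p_cong_prime_mult_iff)
  have "p_cong p 1 (of_nat p * bernoulli (p - 3)) (of_int (power_sum p (p - 3)))"
    using B[of 0] by (auto intro: p_cong_mono)
  also have "p_cong p 1 (of_int (power_sum p (p - 3))) (of_int 0)"
    using power_sum_kummer(2) by (intro p_cong_of_int) (simp add: cong_iff_dvd_diff)
  finally have "p_cong p (Suc 0) (of_nat p * bernoulli (p - 3)) (of_nat p * 0)" by simp
  then show "p_integral p (bernoulli (p - 3))"
    by (simp only: p_cong_prime_mult_iff p_cong_0_iff)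
qed

text \<open>Modulo p, n(p-1) + 1 is 1 - n. This isolates n = 1 as the one exceptional case in the
  estimate of the tail of Faulhaber's formula.\<close>

lemma prime_dvd_Suc_mult_minus_1:
  assumes "1 \<le> n" "n \<le> p" "p dvd Suc (n * (p - 1))"
  shows "n = 1"
proof (rule ccontr)
  assume "n \<noteq> 1"
  have "Suc (n * (p - 1)) + (n - 1) = n * p"
    using assms(1) ge5 by (simp add: algebra_simps)
  then have "p dvd Suc (n * (p - 1)) + (n - 1)" by simp
  then have "p dvd n - 1" using assms(3) by (simp only: dvd_add_right_iff)
  then show False using \<open>n \<noteq> 1\<close> assms by (auto dest: dvd_imp_le)
qed

text \<open>The identity binom(m,i)/(i+1) = binom(m+1,i+1)/(m+1) trades the varying denominator i +
  1 for the fixed m + 1, which is prime to p unless n = 1. Estimating p^(i+1)/(i+1) alone is too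
  weak: for p = 5 and i = 4 both i + 1 and B_{m-i} can put a p into the denominator.\<close>

lemma power_sum_high_terms:
  assumes n: "1 \<le> n" "n \<le> p" and m: "m = n * (p - 1)" and i: "4 \<le> i" "i \<le> m"
  shows "p_cong p 4 (of_nat (m choose i) * bernoulli (m - i) * (of_nat p ^ Suc i / of_nat (Suc i))) 0"
    (is "p_cong p 4 ?t 0")
proof -
  have "Suc m * (m choose i) = (Suc m choose Suc i) * Suc i"
    by (rule Suc_times_binomial_eq)
  then have "of_nat (Suc m) * of_nat (m choose i) = (of_nat (Suc m choose Suc i) * of_nat (Suc i) :: rat)"
    by (metis of_nat_mult)
  then have "of_nat (m choose i) / of_nat (Suc i) = (of_nat (Suc m choose Suc i) / of_nat (Suc m) :: rat)"
    by (simp add: frac_eq_eq mult.commute del: of_nat_Suc binomial_Suc_Suc)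
  moreover have "(of_nat p ^ Suc i :: rat) = of_nat p ^ 4 * (of_nat p * of_nat p ^ (i - 4))"
    using i(1) by (simp flip: power_add power_Suc)
  moreover have "?t = of_nat (m choose i) / of_nat (Suc i) * bernoulli (m - i) * of_nat p ^ Suc i"
    by (simp del: of_nat_Suc power_Suc)
  ultimately have t: "?t = of_nat p ^ 4 *
      (of_nat (Suc m choose Suc i) / of_nat (Suc m) * (of_nat p * bernoulli (m - i)) * of_nat p ^ (i - 4))"
    by (simp only: mult_ac)
  show ?thesis
  proof (cases "p dvd Suc m")
    case False
    show ?thesis
      using False by (intro p_congI[OF _ t[THEN trans[OF diff_zero]]] p_integral_intros p_integral_divide_of_nat p_integral_p_bernoulli)
  next
    case True
    then have "n = 1" using n m prime_dvd_Suc_mult_minus_1 by simp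
    then have p: "Suc m = p" using m ge5 by simp
    show ?thesis
    \<comment> \<open>The denominator m + 1 is now p itself. It cancels against binom(p, i+1),
      except in the last term i = m; that term equals p^(p-1), and p - 1 \<ge> 4.\<close>
    proof (cases "i = m")
      case True
      then have "?t = of_nat p * of_nat p ^ m / of_nat p"
        by (simp add: bernoulli_0 flip: p)
      also have "\<dots> = of_nat p ^ m" using ge5 by simp
      also have "\<dots> = of_nat p ^ 4 * of_nat p ^ (p - 5)"
        using p ge5 by (simp flip: power_add)
      finally have "?t = of_nat p ^ 4 * of_nat p ^ (p - 5)" .
      then show ?thesis by (intro p_congI[of "of_nat p ^ (p - 5)"]) (auto intro: p_integral_intros)
    next
      case False
      then have "p dvd (Suc m choose Suc i)"
        unfolding p using p i ge5 by (intro dvd_choose_prime prime) auto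
      then obtain k where k: "(Suc m choose Suc i) = p * k" ..
      have "p_integral p (of_nat (Suc m choose Suc i) / of_nat (Suc m))"
        unfolding k unfolding p of_nat_mult using ge5 by (simp add: p_integral_of_nat)
      then show ?thesis
        by (intro p_congI[OF _ t[THEN trans[OF diff_zero]]] p_integral_intros p_integral_p_bernoulli)
    qed
  qed
qed

text \<open>The terms i = 0 and i = 2 remain. For i = 1 and i = 3 the Bernoulli index is odd: the
  former is at least 3 and gives zero, the latter can be 1 (when m = 4), but p^4/4 times an integral
  number vanishes modulo p^4 anyway.\<close>

lemma power_sum_cong_bernoulli:
  assumes n: "1 \<le> n" "n \<le> p" and m: "m = n * (p - 1)"
  shows "p_cong p 4 (of_int (power_sum p m))
    (of_nat p * bernoulli m + of_nat p ^ 3 * (of_nat (m choose 2) * bernoulli (m - 2) / 3))"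
proof -
  let ?t = "\<lambda>i. of_nat (m choose i) * bernoulli (m - i) * (of_nat p ^ Suc i / of_nat (Suc i))"
  have "p - 1 \<le> m" using n by (simp add: m)
  then have m4: "m \<ge> 4" using ge5 by simp
  have even: "even m" using even_prime_minus_1 by (simp add: m)
  have t1: "?t 1 = 0" using m4 even by (simp add: bernoulli_odd)
  have "p_integral p (of_nat (m choose 3) * bernoulli (m - 3) / 4)"
    using m4 even by (intro p_integral_intros p_integral_divide_numeral p_integral_bernoulli_odd) auto
  then have t3: "p_cong p 4 (?t 3) 0"
    by (rule p_congI) (simp add: eval_nat_numeral)
  have "{..m} = {0, 1, 2, 3} \<union> {4..m}" using m4 by auto
  then have "sum ?t {..m} = sum ?t ({0, 1, 2, 3} \<union> {4..m})" by simp
  also have "\<dots> = sum ?t {0, 1, 2, 3} + sum ?t {4..m}"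
    by (rule sum.union_disjoint) auto
  also have "sum ?t {0, 1, 2, 3} = ?t 0 + ?t 2 + (?t 1 + ?t 3)"
    by (simp add: power2_eq_square power3_eq_cube power4_eq_xxxx)
  also have "?t 0 = of_nat p * bernoulli m" by simp
  also have "?t 2 = of_nat p ^ 3 * (of_nat (m choose 2) * bernoulli (m - 2) / 3)"
    by (simp add: power3_eq_cube power2_eq_square)
  also have "?t 1 + ?t 3 = ?t 3" by (simp only: t1)
  finally have sum: "sum ?t {..m} = of_nat p * bernoulli m +
      of_nat p ^ 3 * (of_nat (m choose 2) * bernoulli (m - 2) / 3) + ?t 3 + sum ?t {4..m}"
    by (simp only: add.assoc)
  have "p_cong p 4 (sum ?t {4..m}) (\<Sum>i\<in>{4..m}. 0)"
    using power_sum_high_terms[OF n m] by (intro p_cong_sum) auto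
  then have "p_cong p 4 (sum ?t {..m}) (of_nat p * bernoulli m +
      of_nat p ^ 3 * (of_nat (m choose 2) * bernoulli (m - 2) / 3) + 0 + 0)"
    unfolding sum by (intro p_cong_add p_cong_refl t3) simp
  then show ?thesis
    using m4 by (simp only: of_int_power_sum sum_powers_bernoulli add_0_right)
qed

lemma div_bernoulli2_1: "div_bernoulli2 p 1 = bernoulli (p - 3) / of_nat (p - 3)"
proof -
  have "1 * (p - 1) - 2 = p - 3" by simp
  then show ?thesis by (simp only: div_bernoulli2_def)
qed

lemma p_integral_div_bernoulli2: "p_integral p (div_bernoulli2 p 1)"
  unfolding div_bernoulli2_1 using ge5 bernoulli_kummer(2)
  by (intro p_integral_divide_of_nat not_dvd_less) auto

text \<open>Modulo p one has m = -n, so binom(m,2) = n(n+1)/2. Kummer's congruence gives B_{m-2} =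
  (n+2)/3 * B_{p-3}, and B_{p-3} = -3 * \<open>div_bernoulli2 p 1\<close> because p - 3 =
  -3.\<close>

lemma bernoulli_term_cong:
  assumes "1 \<le> n" and m: "m = n * (p - 1)"
  shows "p_cong p 1 (of_nat (m choose 2) * bernoulli (m - 2) / 3)
    (- (of_nat (n * (n + 1) * (n + 2)) / 6 * div_bernoulli2 p 1))"
proof -
  define c where "c = div_bernoulli2 p 1"
  have P: "of_nat (p - k) = (of_nat p - of_nat k :: rat)" if "k \<le> 4" for k
    using ge5 that by (simp add: of_nat_diff)
  have c: "c * of_nat (p - 3) = bernoulli (p - 3)"
    using ge5 by (simp add: c_def div_bernoulli2_1[simplified])
  have c_int: "p_integral p c"
    unfolding c_def by (rule p_integral_div_bernoulli2)
  have "bernoulli (p - 3) = c * (of_nat p - 3)" using c P[of 3] by simp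
  then have c': "p_cong p 1 (bernoulli (p - 3)) (- 3 * c)"
    by (intro p_congI[OF c_int]) (simp add: algebra_simps)
  have "m - 2 = p - 3 + (n - 1) * (p - 1)"
  proof -
    obtain k where "n = Suc k" using assms(1) by (cases n) auto
    then show ?thesis using ge5 by (simp add: m)
  qed
  then have "p_cong p 1 (3 * bernoulli (m - 2)) (of_nat (3 + (n - 1)) * bernoulli (p - 3))"
    by (simp only: bernoulli_kummer(1))
  also have "p_cong p 1 (of_nat (3 + (n - 1)) * bernoulli (p - 3)) (of_nat (3 + (n - 1)) * (- 3 * c))"
    by (intro p_cong_scale c' p_integral_intros)
  also have "of_nat (3 + (n - 1)) = (of_nat (n + 2) :: rat)" using assms(1) by simp
  finally have B: "p_cong p 1 (3 * bernoulli (m - 2)) (of_nat (n + 2) * (- 3 * c))" .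
  have "2 * (m choose 2) = m * (m - 1)"
    using even_prime_minus_1 by (simp add: choose_two m)
  moreover have "m \<ge> 1" using assms ge5 by simp
  ultimately have "2 * of_nat (m choose 2) = (of_nat m * (of_nat m - 1) :: rat)"
    by (metis of_nat_1 of_nat_diff of_nat_mult of_nat_numeral)
  moreover have "of_nat m = of_nat n * (of_nat p - 1 :: rat)"
    using P[of 1] by (simp add: m)
  ultimately have "2 * of_nat (m choose 2) - of_nat (n * (n + 1)) =
      (of_nat p ^ 1 * (of_nat n * (of_nat n * of_nat p - 2 * of_nat n - 1)) :: rat)"
    by (simp add: algebra_simps)
  then have C: "p_cong p 1 (2 * of_nat (m choose 2)) (of_nat (n * (n + 1)))"
    by (rule p_congI[rotated]) (intro p_integral_intros)
  have "p_cong p 1 (2 * of_nat (m choose 2) * (3 * bernoulli (m - 2)))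
      (of_nat (n * (n + 1)) * (of_nat (n + 2) * (- 3 * c)))"
    by (intro p_cong_mult C B p_integral_intros c_int)
  \<comment> \<open>18 = 2 * 3 * 3 clears the denominators of the binomial coefficient, of Kummer's
    congruence and of the quotient by 3.\<close>
  moreover have "2 * of_nat (m choose 2) * (3 * bernoulli (m - 2)) =
      of_nat 18 * (of_nat (m choose 2) * bernoulli (m - 2) / 3)" by simp
  moreover have "of_nat (n * (n + 1)) * (of_nat (n + 2) * (- 3 * c)) =
      of_nat 18 * (- (of_nat (n * (n + 1) * (n + 2)) / 6 * c))"
    by (simp only: of_nat_mult) simp
  ultimately have "p_cong p 1 (of_nat 18 * (of_nat (m choose 2) * bernoulli (m - 2) / 3))
      (of_nat 18 * (- (of_nat (n * (n + 1) * (n + 2)) / 6 * c)))"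
    by (simp only:)
  moreover have "\<not> p dvd 18"
  proof
    assume "p dvd 18"
    then have "p dvd 2 * (3 * 3)" by simp
    then have "p dvd 2 \<or> p dvd 3" by (simp only: prime_dvd_mult_iff[OF prime]) blast
    then show False using ge5 by (auto dest: dvd_imp_le)
  qed
  ultimately show ?thesis unfolding c_def by (rule p_cong_cancel)
qed

text \<open>The definition of the divided Bernoulli number, multiplied by p m, reads p B_m = p - 1 +
  p m * \<open>div_bernoulli p n\<close>. The leading p - 1 counts the summands, each of which is 1
  modulo p.\<close>

lemma power_sum_cong_div_bernoulli:
  assumes n: "1 \<le> n" "n \<le> p"
  shows "p_cong p 4 (of_int (power_sum p (n * (p - 1))))
    (of_nat p - 1 + of_nat p * (of_nat n * (of_nat p - 1) * div_bernoulli p n)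
      - of_nat (n * (n + 1) * (n + 2)) / 6 * div_bernoulli2 p 1 * of_nat p ^ 3)"
proof -
  define m where "m = n * (p - 1)"
  have m0: "(of_nat m :: rat) \<noteq> 0" using n ge5 by (simp add: m_def)
  have "of_nat m = of_nat n * (of_nat p - 1 :: rat)"
    using ge5 by (simp add: m_def of_nat_diff)
  moreover have "bernoulli m + 1 / of_nat p - 1 = of_nat m * div_bernoulli p n"
    using m0 by (simp add: div_bernoulli_def m_def)
  then have "of_nat p * bernoulli m = of_nat p - 1 + of_nat p * (of_nat m * div_bernoulli p n)"
    using ge5 by (simp add: field_simps)
  ultimately have B: "of_nat p * bernoulli m =
      of_nat p - 1 + of_nat p * (of_nat n * (of_nat p - 1) * div_bernoulli p n)" by simp
  have "p_cong p 4 (of_int (power_sum p m))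
    (of_nat p * bernoulli m + of_nat p ^ 3 * (of_nat (m choose 2) * bernoulli (m - 2) / 3))"
    by (rule power_sum_cong_bernoulli[OF n m_def])
  also have "p_cong p 4 \<dots> (of_nat p * bernoulli m +
      of_nat p ^ 3 * (- (of_nat (n * (n + 1) * (n + 2)) / 6 * div_bernoulli2 p 1)))"
    using p_cong_prime_power_mult_iff[of 3 1, simplified, THEN iffD2, OF bernoulli_term_cong[OF n(1) m_def, simplified One_nat_def]]
    by (intro p_cong_add p_cong_refl) (simp only: One_nat_def)
  finally show ?thesis unfolding B by (simp add: m_def mult_ac)
qed

end

subsection \<open>Truncated logarithm and exponential\<close>

text \<open>Cubic truncations of $\log(1 + x)$ and $\exp x$, which are exact modulo $p^4$ for
  $x \in p\mathbb{Z}_p$ and $p \ge 5$.\<close>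

definition log3 :: "rat \<Rightarrow> rat" where
  "log3 x = x - x ^ 2 / 2 + x ^ 3 / 3"

definition exp3 :: "rat \<Rightarrow> rat" where
  "exp3 x = 1 + x + x ^ 2 / 2 + x ^ 3 / 6"

text \<open>The remainder is arranged so that every term has total degree at least 4 in
  \<open>x\<close> and \<open>y\<close>, with denominators 2 and 3 only.\<close>

lemma log3_mult_eq:
  "log3 ((1 + x) * (1 + y) - 1) - (log3 x + log3 y) =
     (x * y) ^ 2 * (x * y / 3 + x + y - 1 / 2) + x * y * (x + y) ^ 2"
  by (simp add: log3_def field_simps power2_eq_square power3_eq_cube)

text \<open>The iterated quotients such as \<open>/ 6 / 6 / 4\<close> are left unreduced on purpose:
  integrality of the cofactor then follows by repeated division by 2, 3, 4 and 6, all prime to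
  p.\<close>

lemma exp3_log3_eq:
  "exp3 (log3 x) - (1 + x) =
     x ^ 4 * (5 / 6 / 4 + x / 2 / 4 - 19 * x ^ 2 / 6 / 6 / 4 + 7 * x ^ 3 / 6 / 6 / 2
       - x ^ 4 / 6 / 6 + x ^ 5 / 6 / 3 / 3 / 3)"
  by (simp add: exp3_def log3_def field_simps power2_eq_square power3_eq_cube eval_nat_numeral)

context prime_ge5
begin

lemma p_integral_log3: "p_integral p x \<Longrightarrow> p_integral p (log3 x)"
  unfolding log3_def by (intro p_integral_intros p_integral_divide_numeral)

lemma p_integral_cong_0: "p_cong p r x 0 \<Longrightarrow> p_integral p x"
  using p_integral_cong p_integral_0 by blast

lemma p_cong_power_0:
  assumes "p_cong p 1 x 0"
  shows "p_cong p n (x ^ n) 0"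
proof (induction n)
  case 0
  then show ?case using p_integral_1 by (simp add: p_cong_0_iff)
next
  case (Suc n)
  then show ?case using p_cong_mult_0[OF assms Suc] by simp
qed

lemma p_cong_mult_0_left: "p_cong p r x 0 \<Longrightarrow> p_integral p c \<Longrightarrow> p_cong p r (x * c) 0"
  using p_cong_scale[of r x 0 c] by (simp add: mult.commute)

lemma log3_mult:
  assumes x: "p_cong p 1 x 0" and y: "p_cong p 1 y 0"
  shows "p_cong p 4 (log3 ((1 + x) * (1 + y) - 1)) (log3 x + log3 y)"
proof -
  have int: "p_integral p x" "p_integral p y" using x y by (auto intro: p_integral_cong_0)
  have xy: "p_cong p 2 (x * y) 0"
    using p_cong_mult_0[OF x y] by (simp add: numeral_2_eq_2)
  then have xy2: "p_cong p 4 ((x * y) ^ 2) 0"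
    using p_cong_mult_0[OF xy xy] by (simp add: power2_eq_square)
  have "p_cong p 1 (x + y) 0" using p_cong_add[OF x y] by simp
  then have "p_cong p 2 ((x + y) ^ 2) 0" by (rule p_cong_power_0)
  then have "p_cong p 4 (x * y * (x + y) ^ 2) 0"
    using p_cong_mult_0[OF xy] by fastforce
  moreover have "p_cong p 4 ((x * y) ^ 2 * (x * y / 3 + x + y - 1 / 2)) 0"
    using xy2 int by (intro p_cong_mult_0_left p_integral_intros p_integral_divide_numeral)
  ultimately have "p_cong p 4 ((x * y) ^ 2 * (x * y / 3 + x + y - 1 / 2) + x * y * (x + y) ^ 2) (0 + 0)"
    by (intro p_cong_add)
  then show ?thesis
    by (subst p_cong_iff) (simp only: log3_mult_eq add_0_right)
qed

text \<open>The first conjunct carries through the induction that partial products stay in 1 + pZ_p,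
  which additivity of the logarithm requires.\<close>

lemma log3_prod:
  assumes "finite A" "\<And>a. a \<in> A \<Longrightarrow> p_cong p 1 (f a - 1) 0"
  shows "p_cong p 1 (prod f A - 1) 0 \<and> p_cong p 4 (log3 (prod f A - 1)) (\<Sum>a\<in>A. log3 (f a - 1))"
  using assms
proof (induction A rule: finite_induct)
  case empty
  show ?case by (simp add: log3_def p_cong_refl)
next
  case (insert a A)
  then have IH: "p_cong p 1 (prod f A - 1) 0" "p_cong p 4 (log3 (prod f A - 1)) (\<Sum>a\<in>A. log3 (f a - 1))"
    and a: "p_cong p 1 (f a - 1) 0" by auto
  have "p_cong p 4 (log3 ((1 + (f a - 1)) * (1 + (prod f A - 1)) - 1))
      (log3 (f a - 1) + log3 (prod f A - 1))"
    using a IH(1) by (rule log3_mult)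
  also have "p_cong p 4 \<dots> (log3 (f a - 1) + (\<Sum>a\<in>A. log3 (f a - 1)))"
    using IH(2) by (intro p_cong_add p_cong_refl)
  finally have "p_cong p 4 (log3 (prod f (insert a A) - 1)) (\<Sum>a\<in>insert a A. log3 (f a - 1))"
    using insert.hyps by simp
  moreover have "p_cong p 1 (prod f (insert a A) - 1) 0"
  proof -
    have "p_cong p 1 ((f a - 1) * prod f A + (prod f A - 1)) (0 + 0)"
      using a IH(1) p_integral_cong[of 1 "prod f A" 1] p_cong_iff[of 1 "prod f A" 1]
      by (intro p_cong_add p_cong_mult_0_left) (auto simp: p_integral_1)
    then show ?thesis using insert.hyps by (simp add: algebra_simps)
  qed
  ultimately show ?case by blast
qed

lemma log3_power:
  assumes "p_cong p 1 x 0"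
  shows "p_cong p 4 (log3 ((1 + x) ^ n - 1)) (of_nat n * log3 x)"
  using log3_prod[of "{..<n}" "\<lambda>_. 1 + x"] assms by simp

lemma exp3_log3:
  assumes "p_cong p 1 x 0"
  shows "p_cong p 4 (exp3 (log3 x)) (1 + x)"
proof -
  have "p_integral p x" using assms by (rule p_integral_cong_0)
  then have "p_cong p 4 (x ^ 4 * (5 / 6 / 4 + x / 2 / 4 - 19 * x ^ 2 / 6 / 6 / 4 + 7 * x ^ 3 / 6 / 6 / 2
       - x ^ 4 / 6 / 6 + x ^ 5 / 6 / 3 / 3 / 3)) 0"
    using p_cong_power_0[OF assms]
    by (intro p_cong_mult_0_left p_integral_intros p_integral_divide_numeral)
  then show ?thesis by (subst p_cong_iff) (simp only: exp3_log3_eq)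
qed

lemma p_cong_divide_numeral:
  assumes "p_cong p r x y"
  shows "p_cong p r (x / 2) (y / 2)" "p_cong p r (x / 3) (y / 3)" "p_cong p r (x / 6) (y / 6)"
  using p_cong_scale[OF assms, of "1 / 2"] p_cong_scale[OF assms, of "1 / 3"]
    p_cong_scale[OF assms, of "1 / 6"] p_integral_divide_numeral[OF p_integral_1] by simp_all

lemma exp3_cong:
  assumes "p_cong p r x y" "p_integral p x" "p_integral p y"
  shows "p_cong p r (exp3 x) (exp3 y)"
  unfolding exp3_def using assms
  by (intro p_cong_add p_cong_divide_numeral p_cong_power p_cong_refl)

end

subsection \<open>Wilson quotients\<close>

context prime_ge5
begin

lemma fermat_cong:
  assumes "a \<in> {1..<p}"
  shows "p_cong p 1 (of_nat a ^ (p - 1) - 1) 0"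
proof -
  have "p_cong p 1 (of_int (int a ^ (p - 1))) (of_int 1)"
    using int_fermat[OF prime assms] by (intro p_cong_of_int) simp
  then show ?thesis by (subst (asm) p_cong_iff) simp
qed

lemma of_int_power_sum_mult:
  "of_int (power_sum p (n * (p - 1))) = (\<Sum>a\<in>{1..<p}. (of_nat a ^ (p - 1)) ^ n :: rat)"
  by (simp add: power_sum_def power_mult mult.commute[of n])

lemma sum_fermat_power_cong:
  "p_cong p n (\<Sum>a\<in>{1..<p}. (of_nat a ^ (p - 1) - 1) ^ n) 0"
proof -
  have "p_cong p n (\<Sum>a\<in>{1..<p}. (of_nat a ^ (p - 1) - 1) ^ n) (\<Sum>a\<in>{1..<p}. 0)"
    by (intro p_cong_sum p_cong_power_0 fermat_cong)
  then show ?thesis by simp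
qed

lemma log3_fact_power:
  "p_cong p 4 (log3 (fact (p - 1) ^ (p - 1) - 1)) (\<Sum>a\<in>{1..<p}. log3 (of_nat a ^ (p - 1) - 1))"
proof -
  have "{1..<p} = {1..p - 1}" using ge5 by auto
  then have "(\<Prod>a\<in>{1..<p}. of_nat a ^ (p - 1)) = (fact (p - 1) ^ (p - 1) :: rat)"
    by (simp add: fact_prod prod_power_distrib)
  then show ?thesis
    using log3_prod[of "{1..<p}" "\<lambda>a. of_nat a ^ (p - 1)"] fermat_cong by simp
qed

lemma p_integral_wilson_quotient: "p_integral p (wilson_quotient p)"
proof -
  have "[fact (p - 1) = (-1 :: int)] (mod int p)"
    using wilson_theorem[OF prime] by simp
  then obtain k where k: "fact (p - 1) + 1 = int p * k"
    by (auto simp: cong_iff_dvd_diff)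
  have "(fact (p - 1) + 1 :: rat) = of_int (fact (p - 1) + 1)" by simp
  also have "\<dots> = of_nat p * of_int k" unfolding k by simp
  finally have "wilson_quotient p = of_int k"
    using ge5 by (simp add: wilson_quotient_def)
  then show ?thesis by (simp add: p_integral_of_int)
qed

lemma of_nat_p_neq_0: "(of_nat p :: rat) \<noteq> 0"
  using ge5 by simp

lemma p_times_wilson_quotient: "of_nat p * wilson_quotient p = fact (p - 1) + 1"
  using of_nat_p_neq_0 by (simp add: wilson_quotient_def)

lemma wilson_quotient_cong:
  defines "b \<equiv> div_bernoulli p" and "c \<equiv> div_bernoulli2 p 1" and "P \<equiv> of_nat p :: rat"
    and "W \<equiv> wilson_quotient p"
  shows "p_cong p 1 W (- b 1)"
    and "p_cong p 2 W (- 2 * b 1 + b 2 - 1 / 2 * P * b 1 ^ 2)"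
    and "p_cong p 3 W (- 3 * b 1 + 3 * b 2 - b 3 + P * (- (3 / 2) * b 1 ^ 2 + b 1 * b 2)
      - P ^ 2 * (1 / 6 * b 1 ^ 3 + 1 / 3 * c))"
proof -
  define s where "s n = (of_int (power_sum p (n * (p - 1))) :: rat)" for n
  define t where "t n = P - 1 + P * (of_nat n * (P - 1) * b n) - of_nat (n * (n + 1) * (n + 2)) / 6 * c * P ^ 3" for n
  have P1: "of_nat (p - 1) = P - 1" using ge5 by (simp add: P_def of_nat_diff)
  have card: "(\<Sum>a\<in>{1..<p}. r) = (P - 1) * r" for r using P1 by simp
  have P_int: "p_integral p P" unfolding P_def by (rule p_integral_of_nat)
  have c_int: "p_integral p c" unfolding c_def by (rule p_integral_div_bernoulli2)
  have cancel: "p_cong p s x y" if "p_cong p (r + s) (P ^ r * x) (P ^ r * y)" for r s x y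
    using that p_cong_prime_power_mult_iff[of r s x y] by (simp add: P_def)
  have cancel_unit: "p_cong p r x y" if "p_cong p r ((P - 1) * x) ((P - 1) * y)" for r x y
    using that p_cong_cancel[of r "p - 1" x y] not_dvd_less[of "p - 1"] ge5 by (simp only: P1) simp
  have cancel_numeral: "p_cong p r x y" if "p_cong p r (of_nat k * x) (of_nat k * y)" "0 < k" "k < 5" for r k x y
    using that p_cong_cancel[of r k x y] not_dvd_less[of k] ge5 by simp

  have st: "p_cong p 4 (s n) (t n)" if "n \<in> {1, 2, 3}" for n
    using power_sum_cong_div_bernoulli[of n] that ge5 unfolding s_def t_def b_def c_def P_def by auto

  have q1: "(\<Sum>a\<in>{1..<p}. (of_nat a ^ (p - 1) - 1) ^ 1) = s 1 - (P - 1)"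
    using of_int_power_sum_mult[of 1] card[of 1] by (simp add: s_def sum_subtractf)
  have q2: "(\<Sum>a\<in>{1..<p}. (of_nat a ^ (p - 1) - 1) ^ 2) = s 2 - 2 * s 1 + (P - 1)"
  proof -
    have "(x - 1) ^ 2 = x ^ 2 - 2 * x ^ 1 + 1" for x :: rat
      by (simp add: power2_eq_square algebra_simps)
    then show ?thesis
      using card[of 1] by (simp only: s_def of_int_power_sum_mult sum_subtractf sum.distrib flip: sum_distrib_left) simp
  qed
  have q3: "(\<Sum>a\<in>{1..<p}. (of_nat a ^ (p - 1) - 1) ^ 3) = s 3 - 3 * s 2 + 3 * s 1 - (P - 1)"
  proof -
    have "(x - 1) ^ 3 = x ^ 3 - 3 * x ^ 2 + 3 * x ^ 1 - 1" for x :: rat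
      by (simp add: power2_eq_square power3_eq_cube algebra_simps)
    then show ?thesis
      using card[of 1] by (simp only: s_def of_int_power_sum_mult sum_subtractf sum.distrib flip: sum_distrib_left) simp
  qed

  have t1: "p_cong p 1 (t 1 - (P - 1)) 0"
    using p_cong_trans[OF p_cong_mono[OF p_cong_diff[OF p_cong_sym[OF st[of 1]] p_cong_refl[of _ "P - 1"]], of 1]
        sum_fermat_power_cong[of 1, unfolded q1]] by simp
  have t2: "p_cong p 2 (t 2 - 2 * t 1 + (P - 1)) 0"
  proof -
    have "p_cong p 4 (t 2 - 2 * t 1 + (P - 1)) (s 2 - 2 * s 1 + (P - 1))"
      by (intro p_cong_add p_cong_diff p_cong_scale p_cong_refl p_integral_intros p_cong_sym[OF st]) auto
    then have "p_cong p 2 (t 2 - 2 * t 1 + (P - 1)) (s 2 - 2 * s 1 + (P - 1))" by (rule p_cong_mono) simp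
    also have "p_cong p 2 \<dots> 0" using sum_fermat_power_cong[of 2] by (simp only: q2)
    finally show ?thesis .
  qed
  have t3: "p_cong p 3 (t 3 - 3 * t 2 + 3 * t 1 - (P - 1)) 0"
  proof -
    have "p_cong p 4 (t 3 - 3 * t 2 + 3 * t 1 - (P - 1)) (s 3 - 3 * s 2 + 3 * s 1 - (P - 1))"
      by (intro p_cong_add p_cong_diff p_cong_scale p_cong_refl p_integral_intros p_cong_sym[OF st]) auto
    then have "p_cong p 3 (t 3 - 3 * t 2 + 3 * t 1 - (P - 1)) (s 3 - 3 * s 2 + 3 * s 1 - (P - 1))"
      by (rule p_cong_mono) simp
    also have "p_cong p 3 \<dots> 0" using sum_fermat_power_cong[of 3] by (simp only: q3)
    finally show ?thesis .
  qed

  \<comment> \<open>The first difference equals P (P - 1) b 1 up to a multiple of P^3; being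
    divisible by p, it makes \<open>b 1\<close> integral after cancelling P and the unit P - 1. The
    second and third differences treat \<open>b 2\<close> and \<open>b 3\<close> in the same
    way.\<close>
  have b1_int: "p_integral p (b 1)"
  proof -
    have "p_cong p 1 (t 1 - (P - 1) + P ^ 1 * (c * P ^ 2)) (0 + P ^ 1 * 0)"
      by (intro p_cong_add t1 p_congI[of "c * P ^ 2"]) (auto intro: p_integral_intros c_int P_int simp: P_def)
    also have "t 1 - (P - 1) + P ^ 1 * (c * P ^ 2) = P ^ 1 * ((P - 1) * b 1)"
      by (simp add: t_def power2_eq_square power3_eq_cube)
    finally have "p_cong p (1 + 0) (P ^ 1 * ((P - 1) * b 1)) (P ^ 1 * ((P - 1) * 0))" by simp
    then show ?thesis using cancel cancel_unit p_cong_0_iff by blast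
  qed
  have b2: "p_cong p 1 (b 2) (b 1)"
  proof -
    have "p_cong p 2 (t 2 - 2 * t 1 + (P - 1) + P ^ 2 * (2 * c * P)) (0 + P ^ 2 * 0)"
      by (intro p_cong_add t2 p_congI[of "2 * c * P"]) (auto intro: p_integral_intros c_int P_int simp: P_def)
    also have "t 2 - 2 * t 1 + (P - 1) + P ^ 2 * (2 * c * P) = P ^ 1 * ((P - 1) * (of_nat 2 * (b 2 - b 1)))"
      by (simp add: t_def power2_eq_square power3_eq_cube field_simps)
    finally have "p_cong p (1 + 1) (P ^ 1 * ((P - 1) * (of_nat 2 * (b 2 - b 1)))) (P ^ 1 * ((P - 1) * (of_nat 2 * 0)))"
      by (simp add: numeral_2_eq_2)
    from cancel_numeral[OF cancel_unit[OF cancel[OF this]]] show ?thesis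
      by (subst p_cong_iff) simp
  qed
  then have b2_int: "p_integral p (b 2)" using b1_int by (rule p_integral_cong)
  have b3: "p_cong p 2 (b 3 - 2 * b 2 + b 1) 0"
  proof -
    have "p_cong p 3 (t 3 - 3 * t 2 + 3 * t 1 - (P - 1) + P ^ 3 * c) (0 + P ^ 3 * 0)"
      by (intro p_cong_add t3 p_congI[of c]) (auto intro: p_integral_intros c_int P_int simp: P_def)
    \<comment> \<open>The values of n(n+1)(n+2)/6 at n = 1, 2, 3 are 1, 4, 10, so the third
      difference contains \<open>c\<close> with coefficient 10 - 3 * 4 + 3 * 1 = 1.\<close>
    also have "t 3 - 3 * t 2 + 3 * t 1 - (P - 1) + P ^ 3 * c =
        P ^ 1 * ((P - 1) * (of_nat 3 * (b 3 - 2 * b 2 + b 1)))"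
      by (simp add: t_def field_simps)
    finally have "p_cong p (1 + 2) (P ^ 1 * ((P - 1) * (of_nat 3 * (b 3 - 2 * b 2 + b 1)))) (P ^ 1 * ((P - 1) * (of_nat 3 * 0)))"
      by (simp add: numeral_3_eq_3)
    from cancel_numeral[OF cancel_unit[OF cancel[OF this]]] show ?thesis by simp
  qed
  have b3_int: "p_integral p (b 3)"
  proof -
    have "p_integral p (b 3 - 2 * b 2 + b 1)" using b3 by (rule p_integral_cong_0)
    then have "p_integral p ((b 3 - 2 * b 2 + b 1) + (2 * b 2 - b 1))"
      by (rule p_integral_add) (intro p_integral_intros b1_int b2_int)
    then show ?thesis by simp
  qed

  \<comment> \<open>\<open>- (P * Y)\<close> is going to be the logarithm of 1 - p W_p modulo p^4.
    The third of \<open>c\<close> is the logarithm's weighting of 1, 4, 10, namely 3 * 1 - (3/2) * 4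
    + (1/3) * 10 = 1/3.\<close>
  define Y where "Y = - 3 * b 1 + 3 * b 2 - b 3 - P ^ 2 * (c / 3)"
  have Y_int: "p_integral p Y" unfolding Y_def
    by (intro p_integral_intros p_integral_divide_numeral b1_int b2_int b3_int c_int P_int)
  have W_int: "p_integral p W" unfolding W_def by (rule p_integral_wilson_quotient)
  have PW: "p_cong p 1 (- (P * W)) 0"
    by (rule p_congI[of "- W"]) (auto intro: p_integral_intros W_int simp: P_def)

  have "p_cong p 4 (of_nat (p - 1) * log3 (- (P * W))) (log3 ((1 + - (P * W)) ^ (p - 1) - 1))"
    using log3_power[OF PW] by (rule p_cong_sym)
  also have "(1 + - (P * W)) ^ (p - 1) = (- fact (p - 1)) ^ (p - 1)"
    by (simp add: P_def W_def p_times_wilson_quotient)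
  also have "\<dots> = fact (p - 1) ^ (p - 1)"
    using even_prime_minus_1 by (rule power_minus_even)
  also have "p_cong p 4 (log3 (fact (p - 1) ^ (p - 1) - 1)) (\<Sum>a\<in>{1..<p}. log3 (of_nat a ^ (p - 1) - 1))"
    by (rule log3_fact_power)
  also have "(\<Sum>a\<in>{1..<p}. log3 (of_nat a ^ (p - 1) - 1)) =
      (s 1 - (P - 1)) - (s 2 - 2 * s 1 + (P - 1)) / 2 + (s 3 - 3 * s 2 + 3 * s 1 - (P - 1)) / 3"
    unfolding q1[symmetric] q2[symmetric] q3[symmetric]
    by (simp add: log3_def sum.distrib sum_subtractf sum_divide_distrib)
  also have "p_cong p 4 \<dots>
      ((t 1 - (P - 1)) - (t 2 - 2 * t 1 + (P - 1)) / 2 + (t 3 - 3 * t 2 + 3 * t 1 - (P - 1)) / 3)"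
    by (intro p_cong_add p_cong_diff p_cong_divide_numeral p_cong_scale p_cong_refl p_integral_intros st) auto
  \<comment> \<open>The contribution -P^3 c/3 lacks the factor P - 1. Supplying it leaves the error
    -P^4 c/3, which vanishes modulo p^4, and the unit P - 1 can then be cancelled as a
    whole.\<close>
  also have "(t 1 - (P - 1)) - (t 2 - 2 * t 1 + (P - 1)) / 2 + (t 3 - 3 * t 2 + 3 * t 1 - (P - 1)) / 3
      = (P - 1) * - (P * Y) - P ^ 4 * (c / 3)"
    by (simp add: t_def Y_def field_simps power2_eq_square power3_eq_cube power4_eq_xxxx)
  also have "p_cong p 4 \<dots> ((P - 1) * - (P * Y))"
    by (rule p_congI[of "- (c / 3)"]) (auto intro!: p_integral_intros p_integral_divide_numeral c_int simp: P_def)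
  finally have L: "p_cong p 4 (log3 (- (P * W))) (- (P * Y))"
    unfolding P1 by (rule cancel_unit)

  have "p_cong p 4 (exp3 (- (P * Y))) (exp3 (log3 (- (P * W))))"
    using p_cong_sym[OF L]
    by (rule exp3_cong) (intro p_integral_log3 p_integral_intros P_int W_int Y_int)+
  also have "p_cong p 4 \<dots> (1 + - (P * W))" using PW by (rule exp3_log3)
  finally have "p_cong p 4 (1 - exp3 (- (P * Y))) (1 - (1 + - (P * W)))"
    by (intro p_cong_diff p_cong_refl)
  also have "1 - exp3 (- (P * Y)) = P ^ 1 * (Y - P * (Y ^ 2 / 2) + P ^ 2 * (Y ^ 3 / 6))"
    by (simp add: exp3_def field_simps power2_eq_square power3_eq_cube)
  finally have "p_cong p (1 + 3) (P ^ 1 * (Y - P * (Y ^ 2 / 2) + P ^ 2 * (Y ^ 3 / 6))) (P ^ 1 * W)"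
    by (simp add: numeral_eq_Suc)
  then have W: "p_cong p 3 W (Y - P * (Y ^ 2 / 2) + P ^ 2 * (Y ^ 3 / 6))"
    by (rule p_cong_sym[OF cancel])

  \<comment> \<open>The difference b 3 - 2 b 2 + b 1 vanishes modulo p^2, which eliminates
    \<open>b 3\<close>.\<close>
  have Y2: "p_cong p 2 Y (- 2 * b 1 + b 2)"
  proof -
    have "p_cong p 2 (- (b 3 - 2 * b 2 + b 1)) (- 0)" using b3 by (rule p_cong_minus)
    moreover have "p_cong p 2 (- (P ^ 2 * (c / 3))) 0"
      by (rule p_congI[of "- (c / 3)"]) (auto intro!: p_integral_intros p_integral_divide_numeral c_int simp: P_def)
    ultimately have "p_cong p 2 (- (b 3 - 2 * b 2 + b 1) + - (P ^ 2 * (c / 3)) + (- 2 * b 1 + b 2))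
        (- 0 + 0 + (- 2 * b 1 + b 2))"
      by (intro p_cong_add p_cong_refl)
    then show ?thesis by (simp add: Y_def algebra_simps)
  qed
  have "p_cong p 1 (- 2 * b 1 + b 2) (- 2 * b 1 + b 1)"
    using b2 by (intro p_cong_add p_cong_refl)
  then have Y1: "p_cong p 1 Y (- b 1)"
    using p_cong_trans[OF p_cong_mono[OF Y2]] by simp
  have Ysq2: "p_cong p 2 (Y ^ 2) (3 * b 1 ^ 2 - 2 * b 1 * b 2)"
  proof -
    have "p_cong p 2 (Y ^ 2) ((- 2 * b 1 + b 2) ^ 2)"
      by (intro p_cong_power Y2 Y_int p_integral_intros b1_int b2_int)
    \<comment> \<open>Splitting off (b 2 - b 1)^2, which is divisible by p^2, trades the square of
      \<open>b 2\<close> for the mixed product \<open>b 1 * b 2\<close> of the final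
      formula.\<close>
    also have "(- 2 * b 1 + b 2) ^ 2 = (3 * b 1 ^ 2 - 2 * b 1 * b 2) + (b 2 - b 1) ^ 2"
      by (simp add: power2_eq_square algebra_simps)
    also have "p_cong p 2 \<dots> ((3 * b 1 ^ 2 - 2 * b 1 * b 2) + 0)"
      using b2 by (intro p_cong_add p_cong_refl p_cong_power_0) (subst (asm) p_cong_iff)
    finally show ?thesis by simp
  qed
  have Ysq1: "p_cong p 1 (Y ^ 2) (b 1 ^ 2)"
    using p_cong_power[OF Y1 Y_int p_integral_minus[OF b1_int], of 2] by simp
  have Ycube: "p_cong p 1 (Y ^ 3) (- (b 1 ^ 3))"
    using p_cong_power[OF Y1 Y_int p_integral_minus[OF b1_int], of 3] by simp
  have mult_P: "p_cong p (r + k) (P ^ r * x) (P ^ r * y)" if "p_cong p k x y" for r k x y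
    using that p_cong_prime_power_mult_iff[of r k x y] by (simp add: P_def)

  show "p_cong p 1 W (- b 1)"
  proof -
    have "p_cong p 1 W (Y - P * (Y ^ 2 / 2) + P ^ 2 * (Y ^ 3 / 6))" using W by (rule p_cong_mono) simp
    also have "p_cong p 1 \<dots> Y"
      by (rule p_congI[of "- (Y ^ 2 / 2) + P * (Y ^ 3 / 6)"])
        (auto intro!: p_integral_intros p_integral_divide_numeral Y_int P_int simp: P_def algebra_simps power2_eq_square)
    also note Y1
    finally show ?thesis .
  qed
  show "p_cong p 2 W (- 2 * b 1 + b 2 - 1 / 2 * P * b 1 ^ 2)"
  proof -
    have "p_cong p 2 W (Y - P * (Y ^ 2 / 2) + P ^ 2 * (Y ^ 3 / 6))" using W by (rule p_cong_mono) simp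
    also have "p_cong p 2 \<dots> (Y - P * (Y ^ 2 / 2))"
      by (rule p_congI[of "Y ^ 3 / 6"])
        (auto intro!: p_integral_intros p_integral_divide_numeral Y_int P_int simp: P_def)
    also have "p_cong p 2 \<dots> ((- 2 * b 1 + b 2) - P * (b 1 ^ 2 / 2))"
      using mult_P[OF p_cong_divide_numeral(1)[OF Ysq1], of 1]
      by (intro p_cong_diff Y2) (simp add: numeral_2_eq_2)
    finally show ?thesis by (simp add: mult.commute)
  qed
  show "p_cong p 3 W (- 3 * b 1 + 3 * b 2 - b 3 + P * (- (3 / 2) * b 1 ^ 2 + b 1 * b 2)
      - P ^ 2 * (1 / 6 * b 1 ^ 3 + 1 / 3 * c))"
  proof -
    note W
    also have "p_cong p 3 (Y - P * (Y ^ 2 / 2) + P ^ 2 * (Y ^ 3 / 6))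
        (Y - P * ((3 * b 1 ^ 2 - 2 * b 1 * b 2) / 2) + P ^ 2 * (- (b 1 ^ 3) / 6))"
      using mult_P[OF p_cong_divide_numeral(1)[OF Ysq2], of 1]
        mult_P[OF p_cong_divide_numeral(3)[OF Ycube], of 2]
      by (intro p_cong_add p_cong_diff p_cong_refl) (simp_all add: numeral_3_eq_3)
    also have "\<dots> = - 3 * b 1 + 3 * b 2 - b 3 + P * (- (3 / 2) * b 1 ^ 2 + b 1 * b 2)
      - P ^ 2 * (1 / 6 * b 1 ^ 3 + 1 / 3 * c)"
      by (simp add: Y_def field_simps)
    finally show ?thesis .
  qed
qed

end

section \<open>The factorial form and the primes 2 and 3\<close>

lemma p_cong_fact:
  assumes "prime p" "p_cong p r (wilson_quotient p) x" "s = Suc r"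
  shows "p_cong p s (fact (p - 1)) (- 1 + of_nat p * x)"
proof -
  interpret prime_nat p by standard fact
  have "(of_nat p :: rat) \<noteq> 0" using prime_gt_0_nat[OF assms(1)] by simp
  then have "fact (p - 1) = - 1 + of_nat p * wilson_quotient p"
    by (simp add: wilson_quotient_def)
  moreover have "p_cong p (Suc r) (- 1 + of_nat p * wilson_quotient p) (- 1 + of_nat p * x)"
    using assms(2) by (intro p_cong_add p_cong_refl) (simp only: p_cong_prime_mult_iff)
  ultimately show ?thesis by (simp only: assms(3))
qed

text \<open>The primes 2 and 3 divide denominators of the truncated logarithm and exponential, so
  they are settled by computation: at 2 both sides are 1, at 3 they are 1 and 1/4, with difference 3
  * (1/4).\<close>

lemma wilson_quotient_cong_1:
  assumes "prime p"
  shows "p_cong p 1 (wilson_quotient p) (- div_bernoulli p 1)"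
proof (cases "p \<ge> 5")
  case True
  then interpret prime_ge5 p using assms by unfold_locales
  show ?thesis by (rule wilson_quotient_cong)
next
  case False
  have "p = 2 \<or> odd p"
    using prime_odd_nat[OF assms] prime_ge_2_nat[OF assms] by linarith
  then have "p = 2 \<or> p = 3"
    using False prime_ge_2_nat[OF assms] by presburger
  then show ?thesis
  proof
    assume p: "p = 2"
    interpret prime_nat 2 by standard simp
    have "wilson_quotient 2 = - div_bernoulli 2 1"
      using bernoulli_1 by (simp add: wilson_quotient_def div_bernoulli_def)
    then show ?thesis using p_cong_refl p by simp
  next
    assume p: "p = 3"
    interpret prime_nat 3 by standard simp
    have "div_bernoulli 3 1 = - 1 / 4"
      using bernoulli_2 by (simp add: div_bernoulli_def)
    moreover have "wilson_quotient 3 = 1" by (simp add: wilson_quotient_def fact_numeral)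
    moreover have "p_integral 3 (1 / of_nat 4)"
      by (intro p_integral_divide_of_nat p_integral_1) simp
    ultimately show ?thesis unfolding p by (intro p_congI[of "1 / 4"]) simp_all
  qed
qed

theorem theorem1p2:
  fixes p :: nat
  assumes "prime p"
  shows "p_cong p 1 (wilson_quotient p) (- div_bernoulli p 1) \<and>
    (p \<ge> 5 \<longrightarrow>
      p_cong p 2 (wilson_quotient p)
        (- 2 * div_bernoulli p 1 + div_bernoulli p 2
         - 1 / 2 * of_nat p * div_bernoulli p 1 ^ 2) \<and>
      p_cong p 3 (wilson_quotient p)
        (- 3 * div_bernoulli p 1 + 3 * div_bernoulli p 2 - div_bernoulli p 3
         + of_nat p * (- (3 / 2) * div_bernoulli p 1 ^ 2 + div_bernoulli p 1 * div_bernoulli p 2)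
         - of_nat p ^ 2 * (1 / 6 * div_bernoulli p 1 ^ 3 + 1 / 3 * div_bernoulli2 p 1))) \<and>
    p_cong p 2 (fact (p - 1)) (- 1 + of_nat p * (- div_bernoulli p 1)) \<and>
    (p \<ge> 5 \<longrightarrow>
      p_cong p 3 (fact (p - 1))
        (- 1 + of_nat p *
          (- 2 * div_bernoulli p 1 + div_bernoulli p 2
           - 1 / 2 * of_nat p * div_bernoulli p 1 ^ 2)) \<and>
      p_cong p 4 (fact (p - 1))
        (- 1 + of_nat p *
          (- 3 * div_bernoulli p 1 + 3 * div_bernoulli p 2 - div_bernoulli p 3
           + of_nat p * (- (3 / 2) * div_bernoulli p 1 ^ 2 + div_bernoulli p 1 * div_bernoulli p 2)
           - of_nat p ^ 2 * (1 / 6 * div_bernoulli p 1 ^ 3 + 1 / 3 * div_bernoulli2 p 1))))"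
proof (intro conjI impI)
  show one: "p_cong p 1 (wilson_quotient p) (- div_bernoulli p 1)"
    using assms by (rule wilson_quotient_cong_1)
  show "p_cong p 2 (fact (p - 1)) (- 1 + of_nat p * (- div_bernoulli p 1))"
    by (rule p_cong_fact[OF assms one]) simp
next
  assume "p \<ge> 5"
  then interpret prime_ge5 p using assms by unfold_locales
  note cong = wilson_quotient_cong(2,3)
  show "p_cong p 2 (wilson_quotient p) (- 2 * div_bernoulli p 1 + div_bernoulli p 2
      - 1 / 2 * of_nat p * div_bernoulli p 1 ^ 2)"
    by (rule cong)
  then show "p_cong p 3 (fact (p - 1)) (- 1 + of_nat p *
      (- 2 * div_bernoulli p 1 + div_bernoulli p 2 - 1 / 2 * of_nat p * div_bernoulli p 1 ^ 2))"
    by (rule p_cong_fact[OF assms]) simp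
  show "p_cong p 3 (wilson_quotient p) (- 3 * div_bernoulli p 1 + 3 * div_bernoulli p 2 - div_bernoulli p 3
      + of_nat p * (- (3 / 2) * div_bernoulli p 1 ^ 2 + div_bernoulli p 1 * div_bernoulli p 2)
      - of_nat p ^ 2 * (1 / 6 * div_bernoulli p 1 ^ 3 + 1 / 3 * div_bernoulli2 p 1))"
    by (rule cong)
  then show "p_cong p 4 (fact (p - 1)) (- 1 + of_nat p *
      (- 3 * div_bernoulli p 1 + 3 * div_bernoulli p 2 - div_bernoulli p 3
       + of_nat p * (- (3 / 2) * div_bernoulli p 1 ^ 2 + div_bernoulli p 1 * div_bernoulli p 2)
       - of_nat p ^ 2 * (1 / 6 * div_bernoulli p 1 ^ 3 + 1 / 3 * div_bernoulli2 p 1)))"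
    by (rule p_cong_fact[OF assms]) simp
qed

end
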